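(* Let $q$ be an odd prime power and let \[ f(X)=aX+\frac{1}{X-r}+\frac{1}{X+r}\in\mathbb{F}_q(X), \] where $a\in\mathbb{F}_q^*$, $r\in\mathbb{F}_{q^2}\setminus\mathbb{F}_q$ and $r^2\in\mathbb{F}_q$. Then $f$ is a permutation rational function of $\mathbb{P}^1(\mathbb{F}_q)$ if and only if $a=-1/(4r^2)$.
   Context: $\mathbb{P}^1(\mathbb{F}_q)=\mathbb{F}_q\cup\{\infty\}$ is the projective line over $\mathbb{F}_q$. A rational function $f=P/Q\in\mathbb{F}_q(X)$ ($P,Q$ coprime) defines a map $\mathbb{P}^1(\mathbb{F}_q)\to\mathbb{P}^1(\mathbb{F}_q)$ in the usual way (zeros of $Q$ map to $\infty$, and $f(\infty)$ is the limiting value). A permutation rational function of $\mathbb{P}^1(\mathbb{F}_q)$ is a rational function whose induced map on $\mathbb{P}^1(\mathbb{F}_q)$ is a bijection. *)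

theory Defs
  imports
    "HOL-Computational_Algebra.Polynomial_Factorial"
    "HOL-Number_Theory.Prime_Powers"
    "HOL-Library.Cardinality"
begin

definition is_subfield :: "'a :: field set \<Rightarrow> bool" where
  "is_subfield K \<longleftrightarrow> 0 \<in> K \<and> 1 \<in> K \<and>
     (\<forall>x\<in>K. \<forall>y\<in>K. x + y \<in> K \<and> x * y \<in> K) \<and>
     (\<forall>x\<in>K. - x \<in> K \<and> inverse x \<in> K)"

text \<open>Rational functions over \<open>L\<close> are elements of \<open>L poly fract\<close>.\<close>

abbreviation ratX :: "'a :: field poly fract" where
  "ratX \<equiv> to_fract [:0, 1:]"

abbreviation ratC :: "'a :: field \<Rightarrow> 'a poly fract" where
  "ratC c \<equiv> to_fract [:c:]"

text \<open>The subfield \<open>K(X)\<close> of \<open>L(X)\<close>, for a subfield \<open>K\<close> of \<open>L\<close>.\<close>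

definition rat_funs_over :: "'a :: field set \<Rightarrow> 'a poly fract set" where
  "rat_funs_over K =
     {Fract P Q | P Q. Q \<noteq> 0 \<and> (\<forall>i. coeff P i \<in> K) \<and> (\<forall>i. coeff Q i \<in> K)}"

datatype 'a proj_line = Pt 'a | Infty

definition proj_line_over :: "'a set \<Rightarrow> 'a proj_line set" where
  "proj_line_over K = insert Infty (Pt ` K)"

fun quot_eval :: "'a :: field poly \<Rightarrow> 'a poly \<Rightarrow> 'a proj_line \<Rightarrow> 'a proj_line" where
  "quot_eval P Q (Pt x) = (if poly Q x = 0 then Infty else Pt (poly P x / poly Q x))"
| "quot_eval P Q Infty =
     (if degree P > degree Q then Infty
      else if degree P = degree Q then Pt (lead_coeff P / lead_coeff Q)
      else Pt 0)"

definition reduced_form :: "'a :: field poly fract \<Rightarrow> 'a poly \<times> 'a poly \<Rightarrow> bool" where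
  "reduced_form f = (\<lambda>(P, Q). Q \<noteq> 0 \<and> coprime P Q \<and> f = Fract P Q)"

definition rat_eval :: "'a :: field poly fract \<Rightarrow> 'a proj_line \<Rightarrow> 'a proj_line" where
  "rat_eval f = (case (SOME PQ. reduced_form f PQ) of (P, Q) \<Rightarrow> quot_eval P Q)"

definition permutation_rat_fun :: "'a :: field set \<Rightarrow> 'a poly fract \<Rightarrow> bool" where
  "permutation_rat_fun K f \<longleftrightarrow>
     f \<in> rat_funs_over K \<and> bij_betw (rat_eval f) (proj_line_over K) (proj_line_over K)"

text \<open>
  Every rational function has a reduced form, and \<^const>\<open>rat_eval\<close> does not depend on the
  choice made.
\<close>

lemma reduced_form_exists: "\<exists>PQ. reduced_form f PQ"
proof -
  define S where "S n \<longleftrightarrow> (\<exists>P Q. Q \<noteq> 0 \<and> f = Fract P Q \<and> degree Q = n)" for n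
  have "\<exists>n. S n"
    by (cases f) (auto simp: S_def)
  define n where "n = (LEAST n. S n)"
  have "S n"
    unfolding n_def using \<open>\<exists>n. S n\<close> by (rule LeastI_ex)
  then obtain P Q where PQ: "Q \<noteq> 0" "f = Fract P Q" "degree Q = n"
    by (auto simp: S_def)
  have "coprime P Q"
  proof (rule coprimeI)
    fix d assume "d dvd P" "d dvd Q"
    then obtain P' Q' where d: "P = d * P'" "Q = d * Q'"
      by (auto elim!: dvdE)
    have nz: "d \<noteq> 0" "Q' \<noteq> 0"
      using d PQ by auto
    have "f = Fract P' Q'"
      using PQ d nz by (simp add: eq_fract mult_ac)
    then have "S (degree Q')"
      using nz by (auto simp: S_def)
    then have "n \<le> degree Q'"
      unfolding n_def by (rule Least_le)
    moreover have "n = degree d + degree Q'"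
      using d PQ nz by (simp add: degree_mult_eq)
    ultimately have "degree d = 0" by simp
    then show "is_unit d"
      using nz by (simp add: is_unit_iff_degree)
  qed
  then show ?thesis
    using PQ by (auto simp: reduced_form_def)
qed

lemma quot_eval_unique:
  assumes "reduced_form f (P, Q)" "reduced_form f (P', Q')"
  shows "quot_eval P Q = quot_eval P' Q'"
proof
  fix z
  have nz: "Q \<noteq> 0" "Q' \<noteq> 0" and cop: "coprime P Q" "coprime P' Q'"
    using assms by (auto simp: reduced_form_def)
  have eq: "P * Q' = P' * Q"
    using assms by (auto simp: reduced_form_def eq_fract)
  show "quot_eval P Q z = quot_eval P' Q' z"
  proof (cases z)
    case (Pt x)
    have e: "poly P x * poly Q' x = poly P' x * poly Q x"
      using eq by (metis poly_mult)
    have "poly P x \<noteq> 0 \<or> poly Q x \<noteq> 0" "poly P' x \<noteq> 0 \<or> poly Q' x \<noteq> 0"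
      using cop coprime_poly_0 by blast+
    then show ?thesis
      using Pt e by (auto simp: frac_eq_eq)
  next
    case Infty
    show ?thesis
    proof (cases "P = 0")
      case True
      then have "P' = 0" using eq nz by simp
      then have "degree Q = 0" "degree Q' = 0"
        using True cop nz by (auto simp: is_unit_iff_degree)
      then show ?thesis using True \<open>P' = 0\<close> Infty by simp
    next
      case False
      then have "P' \<noteq> 0" using eq nz by auto
      have "degree P + degree Q' = degree P' + degree Q"
        using eq False \<open>P' \<noteq> 0\<close> nz by (metis degree_mult_eq)
      moreover have "lead_coeff P * lead_coeff Q' = lead_coeff P' * lead_coeff Q"
        using eq by (metis lead_coeff_mult)
      ultimately show ?thesis
        using Infty nz by (auto simp: frac_eq_eq)
    qed
  qed
qed

lemma rat_eval_eq:
  assumes "Q \<noteq> 0" "coprime P Q"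
  shows "rat_eval (Fract P Q) = quot_eval P Q"
proof -
  obtain P' Q' where s: "(SOME PQ. reduced_form (Fract P Q) PQ) = (P', Q')"
    by fastforce
  have "reduced_form (Fract P Q) (P', Q')"
    using someI_ex[OF reduced_form_exists[of "Fract P Q"]] s by simp
  moreover have "reduced_form (Fract P Q) (P, Q)"
    using assms by (simp add: reduced_form_def)
  ultimately show ?thesis
    using s quot_eval_unique by (auto simp: rat_eval_def)
qed

end

theory Submission
  imports Defs
begin

text \<open>
  Put \<open>s = r\<^sup>2\<close>, a nonsquare in \<open>K\<close>. As \<open>f\<close> fixes \<open>\<infinity>\<close> and has no pole in \<open>K\<close>, it permutes the
  projective line iff \<open>F x = a x + 2 x / (x\<^sup>2 - s)\<close> is injective on \<open>K\<close>.

  If \<open>4 a s = -1\<close>, a collision \<open>F x = F y\<close> with \<open>x \<noteq> y\<close> forces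
  \<open>(4 r a (x - y))\<^sup>2 = (4 a x y - 3)\<^sup>2\<close>, which would put \<open>r\<close> into \<open>K\<close>.

  Conversely, if \<open>F\<close> permutes \<open>K\<close> then \<open>\<Sum> (F x)\<^sup>2 = \<Sum> x\<^sup>2\<close>. The substitution
  \<open>z = (x + r) / (x - r)\<close> maps \<open>K \<union> {\<infinity>}\<close> onto a finite multiplicative group, on which
  \<open>z\<close> and \<open>z\<^sup>2\<close> sum to zero. Since \<open>F x = a x + (z - 1 / z) / (2 r)\<close>, this yields
  \<open>\<Sum> (F x)\<^sup>2 = a\<^sup>2 \<Sum> x\<^sup>2 - 2 a - 1 / (2 s)\<close>, and \<open>(a\<^sup>2 - 1) \<Sum> x\<^sup>2\<close> always vanishes.
\<close>

text \<open>Translation by 1 permutes \<open>K\<close>, so adding 1 to every summand leaves the sum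
  unchanged.\<close>

lemma of_nat_card_subfield:
  fixes K :: "'a :: {field, finite} set"
  assumes "is_subfield K"
  shows "of_nat (card K) = (0 :: 'a)"
proof -
  have "x + 1 \<in> K" "x - 1 \<in> K" if "x \<in> K" for x
    using assms that by (auto simp: is_subfield_def simp flip: add_uminus_conv_diff)
  then have "(\<Sum>x\<in>K. x + 1) = (\<Sum>x\<in>K. x)"
    by (intro sum.reindex_bij_witness[of _ "\<lambda>x. x - 1" "\<lambda>x. x + 1"]) auto
  then show ?thesis
    by (simp add: sum.distrib)
qed

section \<open>The subfield \<open>K\<close>, the root \<open>r\<close> of a nonsquare, and sums
  over \<open>K\<close>\<close>

locale subfield_nonsquare =
  fixes K :: "'a :: {field, finite} set" and r :: 'a
  assumes subfield: "is_subfield K"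
    and r_notin: "r \<notin> K" and r2_in: "r\<^sup>2 \<in> K"
    and two_nonzero: "(2 :: 'a) \<noteq> 0"
begin

lemma zero_in: "0 \<in> K" and one_in: "1 \<in> K"
  using subfield by (auto simp: is_subfield_def)

lemma add_in: "x \<in> K \<Longrightarrow> y \<in> K \<Longrightarrow> x + y \<in> K"
  and mult_in: "x \<in> K \<Longrightarrow> y \<in> K \<Longrightarrow> x * y \<in> K"
  and uminus_in: "x \<in> K \<Longrightarrow> - x \<in> K"
  and inverse_in: "x \<in> K \<Longrightarrow> inverse x \<in> K"
  using subfield by (auto simp: is_subfield_def)

lemma diff_in: "x \<in> K \<Longrightarrow> y \<in> K \<Longrightarrow> x - y \<in> K"
  using add_in[of x "- y"] uminus_in by simp

lemma divide_in: "x \<in> K \<Longrightarrow> y \<in> K \<Longrightarrow> x / y \<in> K"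
  using mult_in[of x "inverse y"] inverse_in by (simp add: field_simps)

lemma power_in: "x \<in> K \<Longrightarrow> x ^ n \<in> K"
  by (induction n) (auto intro: one_in mult_in)

lemma numeral_in: "numeral n \<in> K"
  by (induction n) (simp_all only: numeral.simps one_in add_in)

lemmas closed =
  zero_in one_in add_in mult_in uminus_in diff_in divide_in power_in numeral_in r2_in

lemma four_nonzero: "(4 :: 'a) \<noteq> 0"
proof -
  have "(4 :: 'a) = 2 * 2"
    by simp
  then show ?thesis
    using two_nonzero by (metis mult_eq_0_iff)
qed

lemma r_nonzero: "r \<noteq> 0"
  using r_notin zero_in by auto

lemma diff_r_nonzero: "x \<in> K \<Longrightarrow> x - r \<noteq> 0"
  using r_notin by auto

lemma add_r_nonzero: "x \<in> K \<Longrightarrow> x + r \<noteq> 0"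
  using r_notin uminus_in[of x] by (auto simp: add_eq_0_iff)

lemma square_diff_nonzero:
  assumes "x \<in> K" shows "x\<^sup>2 - r\<^sup>2 \<noteq> 0"
proof -
  have "x\<^sup>2 - r\<^sup>2 = (x - r) * (x + r)"
    by algebra
  then show ?thesis
    using assms diff_r_nonzero add_r_nonzero by simp
qed

lemma sum_uminus: "(\<Sum>x\<in>K. h (- x)) = (\<Sum>x\<in>K. h x)"
  by (rule sum.reindex_bij_witness[of _ uminus uminus]) (auto intro: uminus_in)

lemma sum_one: "(\<Sum>x\<in>K. 1 :: 'a) = 0"
  using of_nat_card_subfield[OF subfield] by simp

lemma sum_squares_scale:
  assumes "a \<in> K" "a \<noteq> 0"
  shows "(\<Sum>x\<in>K. (a * x)\<^sup>2) = (\<Sum>x\<in>K. x\<^sup>2)"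
  by (rule sum.reindex_bij_witness[of _ "\<lambda>x. x / a" "\<lambda>x. a * x"])
     (use assms in \<open>auto intro: closed\<close>)

section \<open>A Moebius substitution and its multiplicative group\<close>

definition mob :: "'a \<Rightarrow> 'a" where
  "mob x = (x + r) / (x - r)"

lemma mob_nonzero: "x \<in> K \<Longrightarrow> mob x \<noteq> 0"
  using diff_r_nonzero add_r_nonzero by (simp add: mob_def)

lemma mob_uminus: "x \<in> K \<Longrightarrow> mob (- x) = 1 / mob x"
  using diff_r_nonzero[of x] add_r_nonzero[of x] diff_r_nonzero[of "- x"] uminus_in[of x]
  by (simp add: mob_def field_simps)

lemma mob_neq_one: "mob x \<noteq> 1" if "x \<in> K"
proof
  assume "mob x = 1"
  then have "2 * r = 0"
    using diff_r_nonzero[OF that] by (simp add: mob_def field_simps)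
  then show False
    using r_nonzero two_nonzero by simp
qed

lemma inj_mob: "inj_on mob K"
proof (rule inj_onI)
  fix x y assume xy: "x \<in> K" "y \<in> K" "mob x = mob y"
  then have "(x + r) * (y - r) = (y + r) * (x - r)"
    using diff_r_nonzero by (simp add: mob_def frac_eq_eq)
  then have "2 * r * (x - y) = 0"
    by algebra
  then show "x = y"
    using r_nonzero two_nonzero by simp
qed

text \<open>The extra 1 is the value of \<open>mob\<close> at infinity. The set is the group of
  elements of norm 1 in \<open>K(r)\<close> over \<open>K\<close>.\<close>

definition mobs :: "'a set" where
  "mobs = insert 1 (mob ` K)"

lemma mobs_mult_aux:
  assumes "x \<in> K" "y \<in> K"
  shows "mob x * mob y \<in> mobs"
proof (cases "x + y = 0")
  case True
  then have "y = - x"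
    by (simp only: add_eq_0_iff)
  then show ?thesis
    using assms by (simp add: mobs_def mob_uminus mob_nonzero)
next
  case False
  \<comment> \<open>Expanding, (x + r)(y + r) = (xy + r^2) + (x + y) r = (x + y)(w + r). Replacing r
    by -r gives (x - r)(y - r) = (x + y)(w - r).\<close>
  define w where "w = (x * y + r\<^sup>2) / (x + y)"
  have w: "w \<in> K"
    unfolding w_def using assms by (intro closed)
  have e: "w * (x + y) = x * y + r\<^sup>2"
    using False by (simp add: w_def)
  have "(x + r) * (y + r) * (w - r) * (x + y) = (w + r) * ((x - r) * (y - r)) * (x + y)"
    using e by algebra
  then have "(x + r) * (y + r) * (w - r) = (w + r) * ((x - r) * (y - r))"
    using False by simp
  then have "mob x * mob y = mob w"
    using assms w diff_r_nonzero by (simp add: mob_def frac_eq_eq)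
  then show ?thesis
    using w by (simp add: mobs_def)
qed

lemma mobs_mult: "g \<in> mobs \<Longrightarrow> h \<in> mobs \<Longrightarrow> g * h \<in> mobs"
  using mobs_mult_aux by (auto simp: mobs_def)

text \<open>Multiplication by \<open>g\<close> permutes the finite set \<open>mobs\<close>, so the
  sum equals \<open>g ^ k\<close> times itself.\<close>

lemma sum_mobs_power:
  assumes "g \<in> mobs" "g ^ k \<noteq> 1"
  shows "(\<Sum>z\<in>mobs. z ^ k) = 0"
proof -
  have "g \<noteq> 0"
    using assms by (auto simp: mobs_def mob_nonzero)
  have inj: "inj_on ((*) g) mobs"
    using \<open>g \<noteq> 0\<close> by (simp add: inj_on_def)
  have "(*) g ` mobs = mobs"
    using mobs_mult[OF assms(1)] inj
    by (intro card_subset_eq) (auto simp: card_image)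
  then have "(\<Sum>z\<in>mobs. z ^ k) = (\<Sum>z\<in>mobs. (g * z) ^ k)"
    by (metis (mono_tags, lifting) inj sum.reindex_cong)
  also have "\<dots> = g ^ k * (\<Sum>z\<in>mobs. z ^ k)"
    by (simp add: power_mult_distrib sum_distrib_left)
  finally show ?thesis
    using assms(2) by (metis mult_cancel_right1)
qed

lemma sum_mobs: "(\<Sum>z\<in>mobs. h z) = h 1 + (\<Sum>x\<in>K. h (mob x))"
  using mob_neq_one inj_mob
  unfolding mobs_def by (subst sum.insert) (auto simp: sum.reindex)

lemma sum_mob: "(\<Sum>x\<in>K. mob x) = -1"
proof -
  have "mob 0 = -1"
    using r_nonzero by (simp add: mob_def)
  moreover have "(-1 :: 'a) \<noteq> 1"
    using two_nonzero by (metis neg_equal_iff_equal one_add_one add_eq_0_iff)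
  ultimately have "mob 0 ^ 1 \<noteq> 1"
    by simp
  from sum_mobs_power[OF _ this] show ?thesis
    using zero_in by (simp add: mobs_def[symmetric] sum_mobs add_eq_0_iff) (simp add: mobs_def)
qed

lemma sum_mob_squared: "(\<Sum>x\<in>K. (mob x)\<^sup>2) = -1"
proof -
  \<comment> \<open>The multiplier -1 = \<open>mob 0\<close> used for first powers has square 1, so
    another element is needed.\<close>
  have "mob 1 ^ 2 \<noteq> 1"
  proof
    assume "mob 1 ^ 2 = 1"
    then have "(1 + r)\<^sup>2 = (1 - r)\<^sup>2"
      using diff_r_nonzero[OF one_in] by (simp add: mob_def power_divide)
    then have "4 * r = 0"
      by algebra
    then show False
      using r_nonzero four_nonzero by simp
  qed
  moreover have "mob 1 \<in> mobs"
    using one_in by (simp add: mobs_def)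
  ultimately have "(\<Sum>z\<in>mobs. z\<^sup>2) = 0"
    by (intro sum_mobs_power)
  then show ?thesis
    by (simp add: sum_mobs add_eq_0_iff)
qed

lemma sum_mob_inverse: "(\<Sum>x\<in>K. 1 / mob x) = -1"
  using sum_uminus[of mob] sum_mob by (simp add: mob_uminus)

lemma sum_mob_inverse_squared: "(\<Sum>x\<in>K. (1 / mob x)\<^sup>2) = -1"
  using sum_uminus[of "\<lambda>x. (mob x)\<^sup>2"] sum_mob_squared by (simp add: mob_uminus)

section \<open>The map induced on \<open>K\<close>: its sum of squares and its injectivity\<close>

definition F :: "'a \<Rightarrow> 'a \<Rightarrow> 'a" where
  "F a x = a * x + 2 * x / (x\<^sup>2 - r\<^sup>2)"

lemma F_in: "a \<in> K \<Longrightarrow> x \<in> K \<Longrightarrow> F a x \<in> K"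
  unfolding F_def by (intro closed)

text \<open>Partial fractions turn the quotient in \<open>F a x\<close> into \<open>u + v\<close>.
  Both \<open>2 * r * (u + v)\<close> and \<open>2 * x * (u + v)\<close> are expressions in
  \<open>z\<close> and \<open>1 / z\<close>. The constants are written \<open>2 * 1\<close> so that
  summation produces the sum of 1 over \<open>K\<close>, to which \<open>sum_one\<close>
  applies.\<close>

lemma F_squared:
  assumes x: "x \<in> K"
  defines "z \<equiv> mob x"
  shows "4 * r\<^sup>2 * (F a x)\<^sup>2 =
    4 * r\<^sup>2 * (a * x)\<^sup>2 + 4 * a * r\<^sup>2 * (z + 2 * 1 + 1 / z) + (z\<^sup>2 - 2 * 1 + (1 / z)\<^sup>2)"
proof -
  define u v where "u = 1 / (x - r)" and "v = 1 / (x + r)"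
  have u: "u * (x - r) = 1" and v: "v * (x + r) = 1"
    using x diff_r_nonzero add_r_nonzero by (auto simp: u_def v_def)
  have z: "z = (x + r) * u" "1 / z = (x - r) * v"
    by (auto simp: z_def mob_def u_def v_def)
  have "x\<^sup>2 - r\<^sup>2 = (x - r) * (x + r)"
    by algebra
  then have "2 * x / (x\<^sup>2 - r\<^sup>2) = 2 * x * (u * v)"
    by (simp add: u_def v_def)
  also have "\<dots> = u + v"
    using u v by algebra
  finally have F: "F a x = a * x + (u + v)"
    by (simp add: F_def)
  have 1: "z - 1 / z = 2 * r * (u + v)"
    \<comment> \<open>\<open>1 / z\<close> has to be replaced before \<open>z\<close>, to leave a
      goal polynomial in \<open>u\<close> and \<open>v\<close>.\<close>
    unfolding z(2) unfolding z(1) using u v by algebra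
  have 2: "2 * x * (u + v) = z + 2 * 1 + 1 / z"
    unfolding z(2) unfolding z(1) using u v by algebra
  have 3: "z * (1 / z) = 1"
    using mob_nonzero[OF x] by (simp add: z_def)
  have "4 * r\<^sup>2 * (F a x)\<^sup>2 =
      4 * r\<^sup>2 * (a * x)\<^sup>2 + 4 * a * r\<^sup>2 * (2 * x * (u + v)) + (2 * r * (u + v))\<^sup>2"
    unfolding F by algebra
  also have "(2 * r * (u + v))\<^sup>2 = z\<^sup>2 - 2 * 1 + (1 / z)\<^sup>2"
    using 1 3 by algebra
  finally show ?thesis
    unfolding 2 .
qed

text \<open>The four sums of powers of \<open>mob x\<close> are all -1 and the constants sum to 0,
  so each bracket contributes -2.\<close>

lemma sum_F_squared:
  "4 * r\<^sup>2 * (\<Sum>x\<in>K. (F a x)\<^sup>2) = 4 * r\<^sup>2 * (\<Sum>x\<in>K. (a * x)\<^sup>2) - 2 * (4 * a * r\<^sup>2 + 1)"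
proof -
  have "4 * r\<^sup>2 * (\<Sum>x\<in>K. (F a x)\<^sup>2) =
    (\<Sum>x\<in>K. 4 * r\<^sup>2 * (a * x)\<^sup>2 + 4 * a * r\<^sup>2 * (mob x + 2 * 1 + 1 / mob x)
       + ((mob x)\<^sup>2 - 2 * 1 + (1 / mob x)\<^sup>2))"
    unfolding sum_distrib_left by (intro sum.cong refl F_squared)
  also have "\<dots> = 4 * r\<^sup>2 * (\<Sum>x\<in>K. (a * x)\<^sup>2)
      + 4 * a * r\<^sup>2 * ((\<Sum>x\<in>K. mob x) + 2 * (\<Sum>x\<in>K. 1) + (\<Sum>x\<in>K. 1 / mob x))
      + ((\<Sum>x\<in>K. (mob x)\<^sup>2) - 2 * (\<Sum>x\<in>K. 1) + (\<Sum>x\<in>K. (1 / mob x)\<^sup>2))"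
    by (simp only: sum.distrib sum_subtractf sum_distrib_left[symmetric])
  also have "\<dots> = 4 * r\<^sup>2 * (\<Sum>x\<in>K. (a * x)\<^sup>2) - 2 * (4 * a * r\<^sup>2 + 1)"
    unfolding sum_one sum_mob sum_mob_inverse sum_mob_squared sum_mob_inverse_squared
    by algebra
  finally show ?thesis .
qed

lemma coefficient_if_inj:
  assumes a: "a \<in> K" "a \<noteq> 0" and inj: "inj_on (F a) K"
  shows "4 * a * r\<^sup>2 = -1"
proof -
  have "F a ` K = K"
    using inj F_in[OF a(1)] by (intro card_subset_eq) (auto simp: card_image)
  then have "(\<Sum>x\<in>K. (F a x)\<^sup>2) = (\<Sum>x\<in>K. x\<^sup>2)"
    by (metis (mono_tags, lifting) inj sum.reindex_cong)
  then have "2 * (4 * a * r\<^sup>2 + 1) = 0"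
    using sum_F_squared[of a] unfolding sum_squares_scale[OF a]
    by (simp only: eq_diff_eq add_cancel_left_right)
  then have "4 * a * r\<^sup>2 + 1 = 0"
    using two_nonzero by (metis mult_eq_0_iff)
  then show ?thesis
    by (simp only: eq_neg_iff_add_eq_0)
qed

lemma inj_if_coefficient:
  assumes a: "a \<in> K" "a \<noteq> 0" and ar: "4 * a * r\<^sup>2 = -1"
  shows "inj_on (F a) K"
proof (rule inj_onI, rule ccontr)
  fix x y assume xy: "x \<in> K" "y \<in> K" "F a x = F a y" "x \<noteq> y"
  define X Y where "X = x\<^sup>2 - r\<^sup>2" and "Y = y\<^sup>2 - r\<^sup>2"
  have nz: "X \<noteq> 0" "Y \<noteq> 0"
    using xy square_diff_nonzero by (auto simp: X_def Y_def)
  have "(a * x * X + 2 * x) * Y = (a * y * Y + 2 * y) * X"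
    using xy(3) nz unfolding F_def X_def[symmetric] Y_def[symmetric]
    by (simp add: field_simps)
  \<comment> \<open>The factor x - y splits off because x Y - y X = -(x - y)(xy + r^2).\<close>
  then have "(x - y) * (a * X * Y - 2 * (x * y + r\<^sup>2)) = 0"
    unfolding X_def Y_def by algebra
  then have "a * X * Y = 2 * (x * y + r\<^sup>2)"
    using xy(4) by simp
  \<comment> \<open>Multiplying by 16 a and using 4 a r^2 = -1 gives -4 a (x - y)^2 = (4 a x y -
    3)^2, whose left side is 16 a^2 r^2 (x - y)^2.\<close>
  then have "(4 * a * (x - y) * r)\<^sup>2 = (4 * a * x * y - 3)\<^sup>2"
    unfolding X_def Y_def using ar by algebra
  then have "4 * a * (x - y) * r = 4 * a * x * y - 3 \<or> 4 * a * (x - y) * r = - (4 * a * x * y - 3)"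
    by (simp only: power2_eq_iff)
  moreover have in_K: "4 * a * x * y - 3 \<in> K"
    using a xy by (intro closed)
  ultimately have "4 * a * (x - y) * r \<in> K"
    using uminus_in[OF in_K] by metis
  then have "4 * a * (x - y) * r / (4 * a * (x - y)) \<in> K"
    using a(1) xy(1,2) by (intro divide_in mult_in[of "4 * a"] mult_in[of 4] diff_in numeral_in)
  moreover have "4 * a * (x - y) \<noteq> 0"
    using a xy(4) four_nonzero by simp
  ultimately show False
    using r_notin by simp
qed

section \<open>Reduced form and the passage to the projective line\<close>

lemma rat_fun_eq:
  "ratC a * ratX + 1 / (ratX - ratC r) + 1 / (ratX + ratC r)
     = Fract [:0, 2 - a * r\<^sup>2, 0, a:] [:- r\<^sup>2, 0, 1:]"
proof -
  define A B where "A = [:- r, 1:]" and "B = [:r, 1:]"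
  have AB: "ratX - ratC r = to_fract A" "ratX + ratC r = to_fract B"
    by (simp_all add: A_def B_def flip: to_fract_diff to_fract_add)
  have nz: "to_fract A \<noteq> 0" "to_fract B \<noteq> 0"
    by (simp_all add: A_def B_def)
  have "ratC a * ratX + 1 / to_fract A + 1 / to_fract B =
      (ratC a * ratX * (to_fract A * to_fract B) + to_fract B + to_fract A)
        / (to_fract A * to_fract B)"
    using nz by (simp add: add_divide_distrib)
  also have "\<dots> = to_fract ([:a:] * [:0, 1:] * (A * B) + B + A) / to_fract (A * B)"
    by (simp only: to_fract_mult to_fract_add)
  also have "A * B = [:- r\<^sup>2, 0, 1:]"
    by (simp add: A_def B_def power2_eq_square)
  also have "[:a:] * [:0, 1:] * [:- r\<^sup>2, 0, 1:] + B + A = [:0, 2 - a * r\<^sup>2, 0, a:]"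
    by (simp add: A_def B_def)
  finally show ?thesis
    unfolding AB by (simp add: Fract_conv_to_fract)
qed

lemma coprime_num_denom: "coprime [:0, 2 - a * r\<^sup>2, 0, a:] [:- r\<^sup>2, 0, 1:]"
proof (rule coprimeI)
  fix d assume d: "d dvd [:0, 2 - a * r\<^sup>2, 0, a:]" "d dvd [:- r\<^sup>2, 0, 1:]"
  \<comment> \<open>Bezout combination: X times the numerator minus a X^2 + 2 times the denominator
    is a nonzero constant.\<close>
  have "d dvd [:0, 1:] * [:0, 2 - a * r\<^sup>2, 0, a:] - [:2, 0, a:] * [:- r\<^sup>2, 0, 1:]"
    using d by (intro dvd_diff dvd_mult)
  also have "[:0, 1:] * [:0, 2 - a * r\<^sup>2, 0, a:] - [:2, 0, a:] * [:- r\<^sup>2, 0, 1:] = [:2 * r\<^sup>2:]"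
    by (simp add: algebra_simps)
  finally have "d dvd [:2 * r\<^sup>2:]" .
  moreover have "is_unit [:2 * r\<^sup>2:]"
    using r_nonzero two_nonzero by (simp add: is_unit_const_poly_iff dvd_field_iff)
  ultimately show "is_unit d"
    by (rule dvd_trans)
qed

lemma permutation_iff_inj:
  assumes "a \<in> K" "a \<noteq> 0"
  shows "permutation_rat_fun K (Fract [:0, 2 - a * r\<^sup>2, 0, a:] [:- r\<^sup>2, 0, 1:])
    \<longleftrightarrow> inj_on (F a) K"
    (is "permutation_rat_fun K (Fract ?P ?Q) \<longleftrightarrow> _")
proof -
  let ?f = "rat_eval (Fract ?P ?Q)" and ?L = "proj_line_over K"
  have f: "?f = quot_eval ?P ?Q"
    by (rule rat_eval_eq) (simp_all add: coprime_num_denom)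
  \<comment> \<open>As a is nonzero, the numerator has degree 3, against 2 for the
    denominator.\<close>
  have f_Infty: "?f Infty = Infty"
    using assms by (simp add: f)
  have f_Pt: "?f (Pt x) = Pt (F a x)" if "x \<in> K" for x
    using square_diff_nonzero[OF that] unfolding f
    by (simp add: F_def field_simps power2_eq_square)
  have maps: "?f ` ?L \<subseteq> ?L"
    using F_in[OF assms(1)] by (auto simp: proj_line_over_def f_Infty f_Pt)
  have coeffs: "coeff ?P i \<in> K" "coeff ?Q i \<in> K" for i
    using assms by (auto simp: coeff_pCons split: nat.splits intro!: closed)
  have "Fract ?P ?Q \<in> rat_funs_over K"
    unfolding rat_funs_over_def using coeffs
    by (intro CollectI exI[of _ ?P] exI[of _ ?Q]) auto
  moreover have "finite ?L"
    by (simp add: proj_line_over_def)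
  ultimately have "permutation_rat_fun K (Fract ?P ?Q) \<longleftrightarrow> inj_on ?f ?L"
    using maps endo_inj_surj[of ?L ?f] unfolding permutation_rat_fun_def bij_betw_def by blast
  also have "\<dots> \<longleftrightarrow> inj_on (F a) K"
    by (auto simp: inj_on_def proj_line_over_def f_Infty f_Pt)
  finally show ?thesis .
qed

end

theorem theorem3p4:
  fixes q :: nat
    and K :: "'l :: {field, finite} set"
    and a r :: 'l
    and f :: "'l poly fract"
  assumes "primepow q" and "odd q"
    and "CARD('l) = q ^ 2"
    and "is_subfield K" and "card K = q"
    and "a \<in> K" and "a \<noteq> 0"
    and "r \<notin> K" and "r ^ 2 \<in> K"
    and "f = ratC a * ratX + 1 / (ratX - ratC r) + 1 / (ratX + ratC r)"
  shows "permutation_rat_fun K f \<longleftrightarrow> a = - 1 / (4 * r ^ 2)"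
proof -
  \<comment> \<open>In characteristic 2 the odd number \<open>q\<close> would be 1 in the field, but
    as the order of \<open>K\<close> it is 0 there.\<close>
  have two: "(2 :: 'l) \<noteq> 0"
  proof
    assume "(2 :: 'l) = 0"
    moreover obtain k where "q = 2 * k + 1"
      using \<open>odd q\<close> by (elim oddE)
    ultimately have "of_nat q = (1 :: 'l)"
      by simp
    then show False
      using of_nat_card_subfield[OF assms(4)] assms(5) by simp
  qed
  interpret subfield_nonsquare K r
    using assms two by unfold_locales auto
  have "4 * r\<^sup>2 \<noteq> 0"
    using four_nonzero r_nonzero by simp
  then have "a = - 1 / (4 * r\<^sup>2) \<longleftrightarrow> 4 * a * r\<^sup>2 = -1"
    by (subst eq_divide_eq) (simp add: mult_ac)
  moreover have "permutation_rat_fun K f \<longleftrightarrow> inj_on (F a) K"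
    using assms(10) rat_fun_eq permutation_iff_inj[OF assms(6,7)] by simp
  ultimately show ?thesis
    using coefficient_if_inj inj_if_coefficient assms(6,7) by blast
qed

end
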